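(* The Multistage model under convex ESS constraints is equivalent to the Enumeration model: a pair $(p^{A\vee},p^{A\wedge})\in\mathbb{R}^T\times\mathbb{R}^T$ is feasible in the Multistage model under convex ESS constraints if and only if it is feasible in the Enumeration model (so that, since both maximize the same objective $\phi(p^{A\vee},p^{A\wedge})$, the two problems have the same optimal solutions and optimal value).
   Context: **Distribution system.** $T\ge 1$ is an integer, $S_T=\{1,\dots,T\}$, $\tau>0$. $S_N$ is a finite set of nodes containing node $1$; $S_D,S_G,S_S\subseteq S_N$ are the sets of loads, generators and energy storage systems (ESSs). For each period $t$ the variables are $p_t^A\in\mathbb{R}$ (aggregate power), $p_t^{SD}=(p_{it}^{SD})_{i\in S_S}$, $p_t^{SC}=(p_{it}^{SC})_{i\in S_S}$, $e_t^S=(e_{it}^S)_{i\in S_S}$ (stored energy), and $y_t=(p_{it}^D,q_{it}^D,p_{it}^G,q_{it}^G,q_{it}^S,p_{it}^N,q_{it}^N)_{i\in S_N}$; quantities of a device type not present at node $i$ are $0$. Real data are given: $\underline P_{it}^D,\overline P_{it}^D,\eta_{it}^D,\underline P_{it}^G,\overline P_{it}^G,\overline S_{it}^G,\overline S_i^S,\underline E_i^S,\overline E_i^S$, with $\overline P_i^{SD},\overline P_i^{SC}>0$, $\kappa_i^S,\eta_i^{SD},\eta_i^{SC}\in(0,1]$, a convex set $C_N$, and a given initial stored energy $e_0^S=(e_{i0}^S)_{i\in S_S}$. **The set $C_t'$.** $C_t'$ is the set of $(p_t^A,p_t^{SD},p_t^{SC},y_t)$ satisfying, with $p_{it}^S:=p_{it}^{SD}-p_{it}^{SC}$: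 $\underline P_{it}^D\le p_{it}^D\le\overline P_{it}^D$ and $q_{it}^D=\eta_{it}^Dp_{it}^D$ for $i\in S_D$; $\underline P_{it}^G\le p_{it}^G\le\overline P_{it}^G$ and $(p_{it}^G)^2+(q_{it}^G)^2\le(\overline S_{it}^G)^2$ for $i\in S_G$; $0\le p_{it}^{SD}\le\overline P_i^{SD}$, $0\le p_{it}^{SC}\le\overline P_i^{SC}$, $p_{it}^{SD}/\overline P_i^{SD}+p_{it}^{SC}/\overline P_i^{SC}\le1$ and $(p_{it}^S)^2+(q_{it}^S)^2\le(\overline S_i^S)^2$ for $i\in S_S$; $p_{it}^N=p_{it}^G+p_{it}^S-p_{it}^D$ and $q_{it}^N=q_{it}^G+q_{it}^S-q_{it}^D$ for $i\in S_N$; $p_t^A=p_{1t}^N$; $((p_{it}^N)_{i\in S_N},(q_{it}^N)_{i\in S_N})\in C_N$. It is assumed that $C_t'$ is convex and closed. **Operational constraints under convex ESS constraints.** $(\mathrm{OC}'_t)$: $(p_t^A,p_t^{SD},p_t^{SC},y_t)\in C_t'$; $e_{it}^S=\kappa_i^Se_{i(t-1)}^S-p_{it}^{SD}\tau/\eta_i^{SD}+p_{it}^{SC}\tau\eta_i^{SC}$ and $\underline E_i^S\le e_{it}^S\le\overline E_i^S$ for all $i\in S_S$. **Models.** $\phi:\mathbb{R}^T\times\mathbb{R}^T\to\mathbb{R}$ is a function; both models maximize $\phi(p^{A\vee},p^{A\wedge})$. *Multistage model under convex ESS constraints:* $(p^{A\vee},p^{A\wedge})$ is feasible if $p_t^{A\vee}\le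 p_t^{A\wedge}$ for all $t\in S_T$ and $\forall p_1^A\in[p_1^{A\vee},p_1^{A\wedge}]\ \exists e_1^S,p_1^{SD},p_1^{SC},y_1\ \forall p_2^A\in[p_2^{A\vee},p_2^{A\wedge}]\ \exists e_2^S,p_2^{SD},p_2^{SC},y_2\ \cdots\ \forall p_T^A\in[p_T^{A\vee},p_T^{A\wedge}]\ \exists e_T^S,p_T^{SD},p_T^{SC},y_T$ such that $(\mathrm{OC}'_t)$ holds for all $t\in S_T$. *Enumeration model:* $(p^{A\vee},p^{A\wedge})$ is feasible if $p_t^{A\vee}\le p_t^{A\wedge}$ for all $t\in S_T$ and there exist functions $e_t^S(\cdot),p_t^{SD}(\cdot),p_t^{SC}(\cdot),y_t(\cdot)$ of $p_{\le t}^A=(p_1^A,\dots,p_t^A)\in\prod_{s\le t}\{p_s^{A\vee},p_s^{A\wedge}\}$, $t\in S_T$, such that for every $p^A\in\prod_{t\in S_T}\{p_t^{A\vee},p_t^{A\wedge}\}$ the values $e_t^S(p_{\le t}^A),p_t^{SD}(p_{\le t}^A),p_t^{SC}(p_{\le t}^A),y_t(p_{\le t}^A)$ satisfy $(\mathrm{OC}'_t)$ for all $t\in S_T$. *)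

theory Defs
  imports "HOL-Analysis.Analysis"
begin

text \<open>
  The node set is the finite type \<open>'n\<close> (so the set of all nodes is \<open>UNIV\<close>), with a
  distinguished node \<open>node1\<close> carrying the aggregate power. Nodal quantities are vectors in
  \<open>real ^ 'n\<close>; a quantity that belongs to a device type is a vector whose entries at nodes without
  such a device are \<open>0\<close>. Periods are the natural numbers \<open>1, \<dots>, horizon\<close>.
\<close>

record ('n::finite) system =
  horizon :: nat
  tau :: real
  node1 :: 'n
  loads :: "'n set"
  gens :: "'n set"
  esss :: "'n set"
  PD_min :: "nat \<Rightarrow> 'n \<Rightarrow> real"
  PD_max :: "nat \<Rightarrow> 'n \<Rightarrow> real"
  eta_D :: "nat \<Rightarrow> 'n \<Rightarrow> real"
  PG_min :: "nat \<Rightarrow> 'n \<Rightarrow> real"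
  PG_max :: "nat \<Rightarrow> 'n \<Rightarrow> real"
  SG_max :: "nat \<Rightarrow> 'n \<Rightarrow> real"
  SS_max :: "'n \<Rightarrow> real"
  PSD_max :: "'n \<Rightarrow> real"
  PSC_max :: "'n \<Rightarrow> real"
  E_min :: "'n \<Rightarrow> real"
  E_max :: "'n \<Rightarrow> real"
  kappa :: "'n \<Rightarrow> real"
  eta_SD :: "'n \<Rightarrow> real"
  eta_SC :: "'n \<Rightarrow> real"
  network :: "((real ^ 'n) \<times> (real ^ 'n)) set"
  e_init :: "real ^ 'n"

text \<open>The components are, in this order, pD, qD, pG, qG, qS, pN, qN.\<close>

type_synonym 'n aux =
  "(real ^ 'n) \<times> (real ^ 'n) \<times> (real ^ 'n) \<times> (real ^ 'n) \<times> (real ^ 'n) \<times> (real ^ 'n) \<times> (real ^ 'n)"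

definition periods :: "('n::finite) system \<Rightarrow> nat set" where
  "periods D = {1..horizon D}"

definition dispatch_set ::
  "('n::finite) system \<Rightarrow> nat \<Rightarrow> (real \<times> (real ^ 'n) \<times> (real ^ 'n) \<times> 'n aux) set" where
  "dispatch_set D t = {(pA, pSD, pSC, (pD, qD, pG, qG, qS, pN, qN)).
     (\<forall>i\<in>loads D. PD_min D t i \<le> pD $ i \<and> pD $ i \<le> PD_max D t i
        \<and> qD $ i = eta_D D t i * pD $ i) \<and>
     (\<forall>i\<in>gens D. PG_min D t i \<le> pG $ i \<and> pG $ i \<le> PG_max D t i
        \<and> (pG $ i)\<^sup>2 + (qG $ i)\<^sup>2 \<le> (SG_max D t i)\<^sup>2) \<and>
     (\<forall>i\<in>esss D. 0 \<le> pSD $ i \<and> pSD $ i \<le> PSD_max D i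
        \<and> 0 \<le> pSC $ i \<and> pSC $ i \<le> PSC_max D i
        \<and> pSD $ i / PSD_max D i + pSC $ i / PSC_max D i \<le> 1
        \<and> (pSD $ i - pSC $ i)\<^sup>2 + (qS $ i)\<^sup>2 \<le> (SS_max D i)\<^sup>2) \<and>
     (\<forall>i. i \<notin> loads D \<longrightarrow> pD $ i = 0 \<and> qD $ i = 0) \<and>
     (\<forall>i. i \<notin> gens D \<longrightarrow> pG $ i = 0 \<and> qG $ i = 0) \<and>
     (\<forall>i. i \<notin> esss D \<longrightarrow> pSD $ i = 0 \<and> pSC $ i = 0 \<and> qS $ i = 0) \<and>
     (\<forall>i. pN $ i = pG $ i + (pSD $ i - pSC $ i) - pD $ i) \<and>
     (\<forall>i. qN $ i = qG $ i + qS $ i - qD $ i) \<and>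
     pA = pN $ node1 D \<and>
     (pN, qN) \<in> network D}"

definition distribution_system :: "('n::finite) system \<Rightarrow> bool" where
  "distribution_system D \<longleftrightarrow>
     1 \<le> horizon D \<and> 0 < tau D \<and>
     (\<forall>i\<in>esss D. 0 < PSD_max D i \<and> 0 < PSC_max D i
        \<and> kappa D i \<in> {0<..1} \<and> eta_SD D i \<in> {0<..1} \<and> eta_SC D i \<in> {0<..1}) \<and>
     convex (network D) \<and>
     (\<forall>t\<in>periods D. convex (dispatch_set D t) \<and> closed (dispatch_set D t))"

definition op_constraints ::
  "('n::finite) system \<Rightarrow> nat \<Rightarrow> real ^ 'n \<Rightarrow> real \<Rightarrow>
     real ^ 'n \<Rightarrow> real ^ 'n \<Rightarrow> real ^ 'n \<Rightarrow> 'n aux \<Rightarrow> bool" where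
  "op_constraints D t e_prev pA e pSD pSC y \<longleftrightarrow>
     (pA, pSD, pSC, y) \<in> dispatch_set D t \<and>
     (\<forall>i\<in>esss D.
        e $ i = kappa D i * e_prev $ i - pSD $ i * tau D / eta_SD D i + pSC $ i * tau D * eta_SC D i
        \<and> E_min D i \<le> e $ i \<and> e $ i \<le> E_max D i) \<and>
     (\<forall>i. i \<notin> esss D \<longrightarrow> e $ i = 0)"

text \<open>
  The operational constraints along whole trajectories, indexed by the period; only the values at
  periods matter, and the energy preceding period 1 is the initial one.
\<close>

definition op_constraints_all ::
  "('n::finite) system \<Rightarrow> (nat \<Rightarrow> real) \<Rightarrow>
     (nat \<Rightarrow> real ^ 'n) \<Rightarrow> (nat \<Rightarrow> real ^ 'n) \<Rightarrow> (nat \<Rightarrow> real ^ 'n) \<Rightarrow> (nat \<Rightarrow> 'n aux) \<Rightarrow> bool" where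
  "op_constraints_all D pA e pSD pSC y \<longleftrightarrow>
     (\<forall>t\<in>periods D. op_constraints D t (if t = 1 then e_init D else e (t - 1))
        (pA t) (e t) (pSD t) (pSC t) (y t))"

text \<open>
  \<open>nested_quantifiers D lo hi k\<close> is the alternating quantifier prefix over the last \<open>k\<close> periods,
  applied to the joint constraints of all periods; the trajectories hold the values chosen so far.
\<close>

primrec nested_quantifiers ::
  "('n::finite) system \<Rightarrow> (nat \<Rightarrow> real) \<Rightarrow> (nat \<Rightarrow> real) \<Rightarrow> nat \<Rightarrow> (nat \<Rightarrow> real) \<Rightarrow>
     (nat \<Rightarrow> real ^ 'n) \<Rightarrow> (nat \<Rightarrow> real ^ 'n) \<Rightarrow> (nat \<Rightarrow> real ^ 'n) \<Rightarrow> (nat \<Rightarrow> 'n aux) \<Rightarrow> bool" where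
  "nested_quantifiers D lo hi 0 pA e pSD pSC y = op_constraints_all D pA e pSD pSC y"
| "nested_quantifiers D lo hi (Suc k) pA e pSD pSC y =
     (let t = horizon D - k in
       \<forall>pA_t\<in>{lo t..hi t}. \<exists>e_t pSD_t pSC_t y_t.
         nested_quantifiers D lo hi k (pA(t := pA_t))
           (e(t := e_t)) (pSD(t := pSD_t)) (pSC(t := pSC_t)) (y(t := y_t)))"

text \<open>The zero trajectories below are placeholders: every period is overwritten.\<close>

definition multistage_feasible ::
  "('n::finite) system \<Rightarrow> (nat \<Rightarrow> real) \<Rightarrow> (nat \<Rightarrow> real) \<Rightarrow> bool" where
  "multistage_feasible D lo hi \<longleftrightarrow>
     (\<forall>t\<in>periods D. lo t \<le> hi t) \<and>
     nested_quantifiers D lo hi (horizon D) (\<lambda>_. 0) (\<lambda>_. 0) (\<lambda>_. 0) (\<lambda>_. 0) (\<lambda>_. 0)"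

text \<open>
  Nonanticipativity: the decision functions of period \<open>t\<close> receive only the restriction of the
  aggregate power trajectory to periods \<open>1, \<dots>, t\<close>.
\<close>

definition enumeration_feasible ::
  "('n::finite) system \<Rightarrow> (nat \<Rightarrow> real) \<Rightarrow> (nat \<Rightarrow> real) \<Rightarrow> bool" where
  "enumeration_feasible D lo hi \<longleftrightarrow>
     (\<forall>t\<in>periods D. lo t \<le> hi t) \<and>
     (\<exists>(e :: nat \<Rightarrow> (nat \<Rightarrow> real) \<Rightarrow> real ^ 'n)
       (pSD :: nat \<Rightarrow> (nat \<Rightarrow> real) \<Rightarrow> real ^ 'n)
       (pSC :: nat \<Rightarrow> (nat \<Rightarrow> real) \<Rightarrow> real ^ 'n)
       (y :: nat \<Rightarrow> (nat \<Rightarrow> real) \<Rightarrow> 'n aux).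
       \<forall>pA \<in> (\<Pi>\<^sub>E t\<in>periods D. {lo t, hi t}).
         op_constraints_all D pA
           (\<lambda>t. e t (restrict pA {1..t})) (\<lambda>t. pSD t (restrict pA {1..t}))
           (\<lambda>t. pSC t (restrict pA {1..t})) (\<lambda>t. y t (restrict pA {1..t})))"

text \<open>Vectors indexed by the periods are functions that are \<open>undefined\<close> outside the periods.\<close>

definition period_vectors :: "('n::finite) system \<Rightarrow> (nat \<Rightarrow> real) set" where
  "period_vectors D = (\<Pi>\<^sub>E t\<in>periods D. UNIV)"

definition multistage_region :: "('n::finite) system \<Rightarrow> ((nat \<Rightarrow> real) \<times> (nat \<Rightarrow> real)) set" where
  "multistage_region D =
     {(lo, hi). lo \<in> period_vectors D \<and> hi \<in> period_vectors D \<and> multistage_feasible D lo hi}"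

definition enumeration_region :: "('n::finite) system \<Rightarrow> ((nat \<Rightarrow> real) \<times> (nat \<Rightarrow> real)) set" where
  "enumeration_region D =
     {(lo, hi). lo \<in> period_vectors D \<and> hi \<in> period_vectors D \<and> enumeration_feasible D lo hi}"

end

theory Submission
  imports Defs
begin

text \<open>
  Both models are unfolded into the same backward recursion: a stored energy is viable if every
  admissible aggregate power of the next period can be served so that the resulting stored energy
  is viable again. Since the operational constraints are jointly convex in all variables, including
  both the preceding and the new stored energy, the viable energies form a convex set, and serving
  the two endpoints of an interval of aggregate powers suffices to serve the whole interval.
\<close>

text \<open>The counter is the number of periods still to come, so in the \<open>Suc k\<close> case
  the next period is \<open>horizon D - k\<close> and \<open>e\<close> is the energy just before it.
  The admissible powers \<open>S\<close> are a parameter so that one recursion covers both intervals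
  and endpoint pairs.\<close>

primrec viable ::
  "('n::finite) system \<Rightarrow> (nat \<Rightarrow> real set) \<Rightarrow> nat \<Rightarrow> real ^ 'n \<Rightarrow> bool" where
  "viable D S 0 e = True"
| "viable D S (Suc k) e =
     (\<forall>p\<in>S (horizon D - k). \<exists>e' pSD pSC y.
        op_constraints D (horizon D - k) e p e' pSD pSC y \<and> viable D S k e')"

section \<open>Convexity and reduction to endpoints\<close>

text \<open>The dispatch set is convex by assumption, the energy bounds are intervals, and the
  energy balance is linear jointly in old energy, new energy and ESS powers. The preceding energies
  \<open>e1\<close> and \<open>e2\<close> may differ, which the backward induction relies
  on.\<close>

lemma op_constraints_convex_comb:
  fixes D :: "('n::finite) system"
  assumes "convex (dispatch_set D t)" "0 \<le> u" "0 \<le> v" "u + v = 1"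
    and 1: "op_constraints D t e1 p1 f1 sd1 sc1 y1"
    and 2: "op_constraints D t e2 p2 f2 sd2 sc2 y2"
  shows "op_constraints D t (u *\<^sub>R e1 + v *\<^sub>R e2) (u * p1 + v * p2) (u *\<^sub>R f1 + v *\<^sub>R f2)
           (u *\<^sub>R sd1 + v *\<^sub>R sd2) (u *\<^sub>R sc1 + v *\<^sub>R sc2) (u *\<^sub>R y1 + v *\<^sub>R y2)"
proof -
  have "u *\<^sub>R (p1, sd1, sc1, y1) + v *\<^sub>R (p2, sd2, sc2, y2) \<in> dispatch_set D t"
    using convexD[OF assms(1) _ _ assms(2-4)] 1 2 unfolding op_constraints_def by blast
  moreover have "E_min D i \<le> (u *\<^sub>R f1 + v *\<^sub>R f2) $ i \<and> (u *\<^sub>R f1 + v *\<^sub>R f2) $ i \<le> E_max D i"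
    if "i \<in> esss D" for i
  proof -
    have "f1 $ i \<in> {E_min D i..E_max D i}" "f2 $ i \<in> {E_min D i..E_max D i}"
      using 1 2 that by (auto simp: op_constraints_def)
    then have "u *\<^sub>R f1 $ i + v *\<^sub>R f2 $ i \<in> {E_min D i..E_max D i}"
      using convexD[OF convex_real_interval(5) _ _ assms(2-4)] by blast
    then show ?thesis by simp
  qed
  moreover have "(u *\<^sub>R f1 + v *\<^sub>R f2) $ i = kappa D i * (u *\<^sub>R e1 + v *\<^sub>R e2) $ i
      - (u *\<^sub>R sd1 + v *\<^sub>R sd2) $ i * tau D / eta_SD D i
      + (u *\<^sub>R sc1 + v *\<^sub>R sc2) $ i * tau D * eta_SC D i" if "i \<in> esss D" for i
  proof -
    have "f1 $ i = kappa D i * e1 $ i - sd1 $ i * tau D / eta_SD D i + sc1 $ i * tau D * eta_SC D i"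
      "f2 $ i = kappa D i * e2 $ i - sd2 $ i * tau D / eta_SD D i + sc2 $ i * tau D * eta_SC D i"
      using 1 2 that by (auto simp: op_constraints_def)
    then show ?thesis
      by (simp only: vector_add_component vector_scaleR_component real_scaleR_def)
        (simp add: algebra_simps add_divide_distrib)
  qed
  ultimately show ?thesis
    using 1 2 by (simp add: op_constraints_def)
qed

text \<open>Here the power \<open>p\<close> is the same from both energies: mixing the two responses
  with the weights \<open>u\<close>, \<open>v\<close> again serves \<open>p\<close>, and the
  resulting energy is viable by induction.\<close>

lemma viable_convex_comb:
  fixes D :: "('n::finite) system"
  assumes "distribution_system D" "k \<le> horizon D" "0 \<le> u" "0 \<le> v" "u + v = 1"
    and "viable D S k e1" "viable D S k e2"
  shows "viable D S k (u *\<^sub>R e1 + v *\<^sub>R e2)"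
  using assms(2,6,7)
proof (induction k arbitrary: e1 e2)
  case (Suc k)
  let ?t = "horizon D - k"
  have conv: "convex (dispatch_set D ?t)"
    using assms(1) Suc.prems(1) by (auto simp: distribution_system_def periods_def)
  have "\<exists>f sd sc y. op_constraints D ?t (u *\<^sub>R e1 + v *\<^sub>R e2) p f sd sc y \<and> viable D S k f"
    if p: "p \<in> S ?t" for p
  proof -
    obtain f1 sd1 sc1 y1 where 1: "op_constraints D ?t e1 p f1 sd1 sc1 y1" "viable D S k f1"
      using Suc.prems(2) p unfolding viable.simps by blast
    obtain f2 sd2 sc2 y2 where 2: "op_constraints D ?t e2 p f2 sd2 sc2 y2" "viable D S k f2"
      using Suc.prems(3) p unfolding viable.simps by blast
    have "u * p + v * p = p"
      using assms(5) by (metis distrib_right mult_1)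
    moreover have "viable D S k (u *\<^sub>R f1 + v *\<^sub>R f2)"
      using Suc.IH[OF _ 1(2) 2(2)] Suc.prems(1) by simp
    ultimately show ?thesis
      using op_constraints_convex_comb[OF conv assms(3-5) 1(1) 2(1)] by metis
  qed
  then show ?case unfolding viable.simps by blast
qed simp

text \<open>Here the energy is fixed and the power varies: a power inside the interval is a mixture
  of the endpoints, and the same mixture of their responses serves it and ends in a viable
  energy.\<close>

lemma viable_endpoints_iff:
  fixes D :: "('n::finite) system"
  assumes "distribution_system D" "k \<le> horizon D" "\<forall>t\<in>periods D. lo t \<le> hi t"
  shows "viable D (\<lambda>t. {lo t..hi t}) k e \<longleftrightarrow> viable D (\<lambda>t. {lo t, hi t}) k e"
  using assms(2)
proof (induction k arbitrary: e)
  case (Suc k)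
  let ?t = "horizon D - k" and ?E = "\<lambda>t. {lo t, hi t}"
  have t: "?t \<in> periods D" using Suc.prems by (auto simp: periods_def)
  then have conv: "convex (dispatch_set D ?t)" and le: "lo ?t \<le> hi ?t"
    using assms(1,3) by (auto simp: distribution_system_def)
  let ?Q = "\<lambda>p. \<exists>f sd sc y. op_constraints D ?t e p f sd sc y \<and> viable D ?E k f"
  have "?Q p" if p: "p \<in> {lo ?t..hi ?t}" and ends: "?Q (lo ?t)" "?Q (hi ?t)" for p
  proof -
    obtain u v where uv: "0 \<le> u" "0 \<le> v" "u + v = 1" and pe: "p = u * lo ?t + v * hi ?t"
    proof -
      have "p \<in> closed_segment (lo ?t) (hi ?t)"
        using p le by (simp add: closed_segment_eq_real_ivl)
      then obtain w where "0 \<le> w" "w \<le> 1" "p = (1 - w) * lo ?t + w * hi ?t"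
        by (auto simp: in_segment)
      then show thesis using that[of "1 - w" w] by simp
    qed
    obtain f1 sd1 sc1 y1 where 1: "op_constraints D ?t e (lo ?t) f1 sd1 sc1 y1" "viable D ?E k f1"
      using ends(1) by blast
    obtain f2 sd2 sc2 y2 where 2: "op_constraints D ?t e (hi ?t) f2 sd2 sc2 y2" "viable D ?E k f2"
      using ends(2) by blast
    \<comment> \<open>Both responses start from the same energy, so their mixture does too.\<close>
    have e: "u *\<^sub>R e + v *\<^sub>R e = e"
      using uv(3) by (metis scaleR_left_distrib scaleR_one)
    have "viable D ?E k (u *\<^sub>R f1 + v *\<^sub>R f2)"
      using viable_convex_comb[OF assms(1) _ uv 1(2) 2(2)] Suc.prems by simp
    with op_constraints_convex_comb[OF conv uv 1(1) 2(1), unfolded e, folded pe]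
    show ?thesis by blast
  qed
  moreover have "lo ?t \<in> {lo ?t..hi ?t}" "hi ?t \<in> {lo ?t..hi ?t}"
    using le by auto
  ultimately have "(\<forall>p\<in>{lo ?t..hi ?t}. ?Q p) \<longleftrightarrow> (\<forall>p\<in>{lo ?t, hi ?t}. ?Q p)"
    by blast
  \<comment> \<open>The induction hypothesis handles the later periods; \<open>?Q\<close>, stated
    with endpoint viability, handled the current one.\<close>
  moreover have "viable D (\<lambda>t. {lo t..hi t}) k f \<longleftrightarrow> viable D ?E k f" for f
    using Suc by simp
  ultimately show ?case by (simp only: viable.simps)
qed simp

section \<open>The quantifier prefix as a backward recursion\<close>

text \<open>The prefix imposes all constraints only at its innermost level. Constraints of periods
  already decided do not involve later choices, so they can be pulled out, and what remains depends
  on the past only through the last energy.\<close>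

lemma nested_quantifiers_iff_viable:
  fixes D :: "('n::finite) system"
  assumes "k \<le> horizon D" "\<forall>t\<in>periods D. lo t \<le> hi t"
  shows "nested_quantifiers D lo hi k pA e pSD pSC y \<longleftrightarrow>
    (\<forall>t\<in>{1..horizon D - k}. op_constraints D t (if t = 1 then e_init D else e (t - 1))
        (pA t) (e t) (pSD t) (pSC t) (y t)) \<and>
    viable D (\<lambda>t. {lo t..hi t}) k (if k = horizon D then e_init D else e (horizon D - k))"
  using assms(1)
proof (induction k arbitrary: pA e pSD pSC y)
  case 0
  then show ?case by (simp add: op_constraints_all_def periods_def)
next
  case (Suc k)
  let ?t = "horizon D - k"
  let ?C = "\<lambda>t. op_constraints D t (if t = 1 then e_init D else e (t - 1))
        (pA t) (e t) (pSD t) (pSC t) (y t)"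
  let ?prev = "if Suc k = horizon D then e_init D else e (horizon D - Suc k)"
  have t: "{1..?t} = insert ?t {1..horizon D - Suc k}" "?t \<notin> {1..horizon D - Suc k}"
    using Suc.prems by auto
  have "lo ?t \<le> hi ?t" using assms(2) Suc.prems by (auto simp: periods_def)
  \<comment> \<open>Past constraints can leave the universal quantifier over powers only if its
    range is nonempty.\<close>
  then have ne: "{lo ?t..hi ?t} \<noteq> {}" by simp
  have step: "nested_quantifiers D lo hi k (pA(?t := p)) (e(?t := f)) (pSD(?t := sd))
      (pSC(?t := sc)) (y(?t := z)) \<longleftrightarrow>
    (\<forall>s\<in>{1..horizon D - Suc k}. ?C s) \<and>
    op_constraints D ?t ?prev p f sd sc z \<and> viable D (\<lambda>t. {lo t..hi t}) k f" for p f sd sc z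
  proof -
    let ?C' = "\<lambda>s. op_constraints D s (if s = 1 then e_init D else (e(?t := f)) (s - 1))
        ((pA(?t := p)) s) ((e(?t := f)) s) ((pSD(?t := sd)) s) ((pSC(?t := sc)) s) ((y(?t := z)) s)"
    \<comment> \<open>Overwriting the trajectories at \<open>?t\<close> leaves the earlier periods
      untouched, as these read only the values at \<open>s\<close> and \<open>s - 1\<close>.\<close>
    have "?C' s \<longleftrightarrow> ?C s" if "s \<in> {1..horizon D - Suc k}" for s
    proof -
      have "s \<noteq> ?t" "s - 1 \<noteq> ?t" using that by auto
      then show ?thesis by simp
    qed
    moreover have "?C' ?t \<longleftrightarrow> op_constraints D ?t ?prev p f sd sc z"
    proof -
      have "?t - 1 \<noteq> ?t" "?t = 1 \<longleftrightarrow> Suc k = horizon D" "?t - 1 = horizon D - Suc k"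
        using Suc.prems by auto
      then show ?thesis by simp
    qed
    ultimately have all: "(\<forall>s\<in>{1..?t}. ?C' s) \<longleftrightarrow>
        (\<forall>s\<in>{1..horizon D - Suc k}. ?C s) \<and> op_constraints D ?t ?prev p f sd sc z"
      unfolding t(1) by (metis insert_iff)
    have k: "k \<le> horizon D" "k \<noteq> horizon D" using Suc.prems by auto
    show ?thesis
      unfolding Suc.IH[OF k(1)] all by (simp add: k(2))
  qed
  have "nested_quantifiers D lo hi (Suc k) pA e pSD pSC y \<longleftrightarrow>
    (\<forall>p\<in>{lo ?t..hi ?t}. \<exists>f sd sc z. (\<forall>s\<in>{1..horizon D - Suc k}. ?C s) \<and>
      op_constraints D ?t ?prev p f sd sc z \<and> viable D (\<lambda>t. {lo t..hi t}) k f)"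
    unfolding nested_quantifiers.simps Let_def step ..
  also have "\<dots> \<longleftrightarrow> (\<forall>s\<in>{1..horizon D - Suc k}. ?C s) \<and>
      viable D (\<lambda>t. {lo t..hi t}) (Suc k) ?prev"
    unfolding viable.simps using ne by blast
  finally show ?case .
qed

lemma multistage_feasible_iff_viable:
  fixes D :: "('n::finite) system"
  shows "multistage_feasible D lo hi \<longleftrightarrow> (\<forall>t\<in>periods D. lo t \<le> hi t) \<and>
    viable D (\<lambda>t. {lo t..hi t}) (horizon D) (e_init D)"
  unfolding multistage_feasible_def
  by (auto simp: nested_quantifiers_iff_viable)

section \<open>Nonanticipative policies and viability\<close>

text \<open>The policy's own values witness viability of every energy it reaches, whichever scenario
  \<open>pA\<close> led there.\<close>

lemma viable_of_policy:
  fixes D :: "('n::finite) system"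
  assumes policy: "\<And>pA. pA \<in> (\<Pi>\<^sub>E t\<in>periods D. S t) \<Longrightarrow> op_constraints_all D pA
      (\<lambda>t. e t (restrict pA {1..t})) (\<lambda>t. pSD t (restrict pA {1..t}))
      (\<lambda>t. pSC t (restrict pA {1..t})) (\<lambda>t. y t (restrict pA {1..t}))"
    and "k \<le> horizon D" "pA \<in> (\<Pi>\<^sub>E t\<in>periods D. S t)"
  shows "viable D S k
    (if k = horizon D then e_init D else e (horizon D - k) (restrict pA {1..horizon D - k}))"
  using assms(2,3)
proof (induction k arbitrary: pA)
  case (Suc k)
  let ?t = "horizon D - k" and ?m = "horizon D - Suc k"
  let ?prev = "if Suc k = horizon D then e_init D else e ?m (restrict pA {1..?m})"
  have t: "?t \<in> periods D" using Suc.prems by (auto simp: periods_def)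
  have "\<exists>f sd sc z. op_constraints D ?t ?prev p f sd sc z \<and> viable D S k f" if p: "p \<in> S ?t" for p
  proof -
    \<comment> \<open>The scenario is redirected to \<open>p\<close> at \<open>?t\<close>; the
      induction hypothesis applies to it since it ranges over all scenarios.\<close>
    let ?q = "pA(?t := p)"
    have q: "?q \<in> (\<Pi>\<^sub>E t\<in>periods D. S t)"
      using Suc.prems(2) p t by (auto simp: PiE_iff extensional_def)
    have "op_constraints D ?t (if ?t = 1 then e_init D else e (?t - 1) (restrict ?q {1..?t - 1}))
        (?q ?t) (e ?t (restrict ?q {1..?t})) (pSD ?t (restrict ?q {1..?t}))
        (pSC ?t (restrict ?q {1..?t})) (y ?t (restrict ?q {1..?t}))"
      using policy[OF q] t unfolding op_constraints_all_def by blast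
    moreover have "?t = 1 \<longleftrightarrow> Suc k = horizon D" "?t - 1 = ?m" using Suc.prems(1) by auto
    \<comment> \<open>Nonanticipativity enters here: the energy before \<open>?t\<close> is the same
      under \<open>pA\<close> and \<open>?q\<close>.\<close>
    moreover have "restrict ?q {1..?m} = restrict pA {1..?m}"
      using Suc.prems(1) by (intro restrict_ext) auto
    moreover have "viable D S k (e ?t (restrict ?q {1..?t}))"
      using Suc.IH[OF _ q] Suc.prems(1) by auto
    ultimately show ?thesis
      by (cases "Suc k = horizon D"; simp del: split_paired_Ex; blast)
  qed
  then show ?case unfolding viable.simps by blast
qed simp

text \<open>A response that keeps the energy viable is chosen in each period, and the energy is
  propagated forward from \<open>e_init D\<close>. Each choice depends only on the powers seen so
  far.\<close>

lemma policy_of_viable: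
  fixes D :: "('n::finite) system"
  assumes "viable D S (horizon D) (e_init D)"
  obtains e pSD pSC y where "\<And>pA. pA \<in> (\<Pi>\<^sub>E t\<in>periods D. S t) \<Longrightarrow> op_constraints_all D pA
      (\<lambda>t. e t (restrict pA {1..t})) (\<lambda>t. pSD t (restrict pA {1..t}))
      (\<lambda>t. pSC t (restrict pA {1..t})) (\<lambda>t. y t (restrict pA {1..t}))"
proof -
  define good where "good = (\<lambda>t e p (f, sd, sc, z).
    op_constraints D t e p f sd sc z \<and> viable D S (horizon D - t) f)"
  define pick where "pick = (\<lambda>t e p. SOME x. good t e p x)"
  \<comment> \<open>The energy after \<open>t\<close> periods when the choices \<open>pick\<close>
    are followed along \<open>pA\<close>.\<close>
  define state where "state = (\<lambda>(pA :: nat \<Rightarrow> real) t. rec_nat (e_init D)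
    (\<lambda>t e. fst (pick (Suc t) e (pA (Suc t)))) t)"
  define decision where "decision = (\<lambda>t pA. pick t (state pA (t - 1)) (pA t))"
  have state_simps: "state pA 0 = e_init D"
    "state pA (Suc t) = fst (pick (Suc t) (state pA t) (pA (Suc t)))" for pA t
    by (simp_all add: state_def)
  have state_cong: "state pA t = state qA t" if "\<And>s. s \<in> {1..t} \<Longrightarrow> pA s = qA s" for pA qA t
    using that by (induction t) (simp_all add: state_simps)
  have restr: "decision t (restrict pA {1..t}) = decision t pA" if "1 \<le> t" for pA t
  proof -
    have "state (restrict pA {1..t}) (t - 1) = state pA (t - 1)"
      by (rule state_cong) auto
    then show ?thesis using that by (simp add: decision_def)
  qed
  have state_decision: "state pA t = fst (decision t pA)" if "1 \<le> t" for pA t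
    using that by (cases t) (simp_all add: state_simps decision_def)
  have pick: "good t e p (pick t e p)"
    if "viable D S (horizon D - (t - 1)) e" "t \<in> periods D" "p \<in> S t" for t e p
  proof -
    \<comment> \<open>Before period \<open>t\<close> exactly one more period remains than after it,
      so \<open>viable\<close> unfolds once and its next period is \<open>t\<close>.\<close>
    have "horizon D - (t - 1) = Suc (horizon D - t)" "horizon D - (horizon D - t) = t"
      using that(2) by (auto simp: periods_def)
    then have "\<exists>x. good t e p x"
      using that(1,3) by (simp add: good_def)
    then show ?thesis unfolding pick_def by (rule someI_ex)
  qed
  have viable_state: "viable D S (horizon D - t) (state pA t)"
    if pA: "pA \<in> (\<Pi>\<^sub>E t\<in>periods D. S t)" and "t \<le> horizon D" for pA t
    using that(2)
  proof (induction t)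
    case 0
    then show ?case using assms by (simp add: state_simps)
  next
    case (Suc t)
    have "good (Suc t) (state pA t) (pA (Suc t)) (pick (Suc t) (state pA t) (pA (Suc t)))"
      using Suc pA by (intro pick) (auto simp: periods_def)
    then show ?case by (auto simp: good_def state_simps split: prod.splits)
  qed
  have "op_constraints D t (if t = 1 then e_init D else fst (decision (t - 1) (restrict pA {1..t - 1})))
      (pA t) (fst (decision t (restrict pA {1..t}))) (fst (snd (decision t (restrict pA {1..t}))))
      (fst (snd (snd (decision t (restrict pA {1..t})))))
      (snd (snd (snd (decision t (restrict pA {1..t})))))"
    if pA: "pA \<in> (\<Pi>\<^sub>E t\<in>periods D. S t)" and t: "t \<in> periods D" for pA t
  proof -
    have t1: "1 \<le> t" "t - 1 \<le> horizon D" using t by (auto simp: periods_def)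
    have "good t (state pA (t - 1)) (pA t) (decision t pA)"
      unfolding decision_def using viable_state[OF pA t1(2)] pA t by (intro pick) auto
    moreover have "state pA (t - 1) =
        (if t = 1 then e_init D else fst (decision (t - 1) (restrict pA {1..t - 1})))"
      using t1(1) state_decision[of "t - 1" pA] restr[of "t - 1" pA] by (auto simp: state_simps)
    ultimately show ?thesis
      unfolding restr[OF t1(1)] by (auto simp: good_def split: prod.splits)
  qed
  then show thesis
    by (intro that[of "\<lambda>t f. fst (decision t f)" "\<lambda>t f. fst (snd (decision t f))"
          "\<lambda>t f. fst (snd (snd (decision t f)))" "\<lambda>t f. snd (snd (snd (decision t f)))"])
      (unfold op_constraints_all_def, blast)
qed

lemma enumeration_feasible_iff_viable:
  fixes D :: "('n::finite) system"
  shows "enumeration_feasible D lo hi \<longleftrightarrow> (\<forall>t\<in>periods D. lo t \<le> hi t) \<and>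
    viable D (\<lambda>t. {lo t, hi t}) (horizon D) (e_init D)"
    (is "_ \<longleftrightarrow> ?le \<and> ?V")
proof
  assume enum: "enumeration_feasible D lo hi"
  then obtain e pSD pSC y where "\<And>pA. pA \<in> (\<Pi>\<^sub>E t\<in>periods D. {lo t, hi t}) \<Longrightarrow>
      op_constraints_all D pA
      (\<lambda>t. e t (restrict pA {1..t})) (\<lambda>t. pSD t (restrict pA {1..t}))
      (\<lambda>t. pSC t (restrict pA {1..t})) (\<lambda>t. y t (restrict pA {1..t}))"
    unfolding enumeration_feasible_def by blast
  \<comment> \<open>Any scenario would do, such as the one of all lower bounds: with every period
    still to come, the conclusion concerns only \<open>e_init D\<close>.\<close>
  from viable_of_policy[OF this order_refl, where pA = "restrict lo (periods D)"] have ?V by auto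
  then show "?le \<and> ?V" using enum by (simp add: enumeration_feasible_def)
next
  assume feasible: "?le \<and> ?V"
  then have ?V ..
  then obtain e pSD pSC y where policy: "\<And>pA. pA \<in> (\<Pi>\<^sub>E t\<in>periods D. {lo t, hi t}) \<Longrightarrow>
      op_constraints_all D pA
      (\<lambda>t. e t (restrict pA {1..t})) (\<lambda>t. pSD t (restrict pA {1..t}))
      (\<lambda>t. pSC t (restrict pA {1..t})) (\<lambda>t. y t (restrict pA {1..t}))"
    by (rule policy_of_viable) blast
  show "enumeration_feasible D lo hi"
    unfolding enumeration_feasible_def
    by (intro conjI exI[of _ e] exI[of _ pSD] exI[of _ pSC] exI[of _ y] ballI policy)
      (use feasible in blast)+
qed

theorem corollary1:
  fixes D :: "('n::finite) system"
    and \<phi> :: "(nat \<Rightarrow> real) \<times> (nat \<Rightarrow> real) \<Rightarrow> real"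
  assumes "distribution_system D"
  shows "(\<forall>lo\<in>period_vectors D. \<forall>hi\<in>period_vectors D.
            multistage_feasible D lo hi \<longleftrightarrow> enumeration_feasible D lo hi) \<and>
         (\<forall>z. is_arg_max \<phi> (\<lambda>w. w \<in> multistage_region D) z \<longleftrightarrow>
              is_arg_max \<phi> (\<lambda>w. w \<in> enumeration_region D) z) \<and>
         (SUP z\<in>multistage_region D. ereal (\<phi> z)) = (SUP z\<in>enumeration_region D. ereal (\<phi> z))"
proof -
  have iff: "multistage_feasible D lo hi \<longleftrightarrow> enumeration_feasible D lo hi" for lo hi
    unfolding multistage_feasible_iff_viable enumeration_feasible_iff_viable
    using viable_endpoints_iff[OF assms order_refl] by blast
  \<comment> \<open>Equal feasible regions give the same maximizers and supremum for any
    objective.\<close>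
  then have "multistage_region D = enumeration_region D"
    by (simp add: multistage_region_def enumeration_region_def)
  then show ?thesis using iff by simp
qed

end
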